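(* Let $n\ge3$ and let $(\mathfrak{r}_{2n+2},\cdot,[-,-])$ be a transposed Poisson algebra structure defined on the Lie algebra $\mathfrak{r}_{2n+2}$. Then the multiplication of $(\mathfrak{r}_{2n+2},\cdot)$ has the following form: $$\mathbf{TP}(\mathfrak{r}_{2n+2}):\quad x_1\cdot x_1=(2n+1)^2e_{2n},\quad x_1\cdot x_2=2(2n+1)e_{2n},\quad x_2\cdot x_2=4e_{2n},$$ where the transposed Poisson algebra also has its products with respect to the bracket $[-,-]$, and the remaining products of basis elements under $\cdot$ (those not listed, up to commutativity) are equal to zero.
   Context: All algebras are over $\mathbb{C}$. A transposed Poisson algebra is a vector space $\mathfrak{L}$ with bilinear operations $\cdot$ and $[-,-]$ such that $(\mathfrak{L},\cdot)$ is a commutative associative algebra, $(\mathfrak{L},[-,-])$ is a Lie algebra, and $2z\cdot[u,v]=[z\cdot u,v]+[u,z\cdot v]$ for all $u,v,z\in\mathfrak{L}$. A transposed Poisson structure on a Lie algebra $(\mathfrak{L},[-,-])$ is an operation $\cdot$ making $(\mathfrak{L},\cdot,[-,-])$ a transposed Poisson algebra. $\mathfrak{r}_{2n+2}$ is the $(2n+2)$-dimensional Lie algebra with basis $e_1,\dots,e_{2n},x_1,x_2$ and brackets $[e_i,e_1]=e_{i+1}$ for $2\le i\le 2n-2$; $[e_i,e_{2n+1-i}]=(-1)^ie_{2n}$ for $2\le i\le n$; $[e_i,x_1]=ie_i$ for $1\le i\le 2n-1$; $[e_{2n},x_1]=(2n+1)e_{2n}$; $[e_i,x_2]=e_i$ for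 $2\le i\le 2n-1$; $[e_{2n},x_2]=2e_{2n}$; brackets of basis elements not determined by these and antisymmetry are zero.
   Formalization: The zero product and all scalar multiples of the table are also transposed Poisson structures, so the claim is proved as: the product is zero, or it has the displayed form in some basis satisfying the same brackets of r_{2n+2}. *)

theory Defs
  imports Complex_Main
begin

text \<open>Complex vector spaces are given by the locale \<^locale>\<open>vector_space\<close> with scalars of type
  \<^typ>\<open>complex\<close>; the underlying space is the whole type.\<close>

locale complex_lie_algebra = vector_space scale
  for scale :: "complex \<Rightarrow> 'a::ab_group_add \<Rightarrow> 'a" (infixr "*s" 75) +
  fixes lie :: "'a \<Rightarrow> 'a \<Rightarrow> 'a"
  assumes lie_linear_left: "Vector_Spaces.linear scale scale (\<lambda>u. lie u v)"
    and lie_linear_right: "Vector_Spaces.linear scale scale (\<lambda>v. lie u v)"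
    and lie_alternating: "lie u u = 0"
    and jacobi: "lie u (lie v w) + lie v (lie w u) + lie w (lie u v) = 0"

locale transposed_poisson_algebra = complex_lie_algebra scale lie
  for scale :: "complex \<Rightarrow> 'a::ab_group_add \<Rightarrow> 'a" (infixr "*s" 75)
    and lie :: "'a \<Rightarrow> 'a \<Rightarrow> 'a" +
  fixes mult :: "'a \<Rightarrow> 'a \<Rightarrow> 'a" (infixl "\<cdot>" 70)
  assumes mult_linear_left: "Vector_Spaces.linear scale scale (\<lambda>u. u \<cdot> v)"
    and mult_linear_right: "Vector_Spaces.linear scale scale (\<lambda>v. u \<cdot> v)"
    and mult_commute: "u \<cdot> v = v \<cdot> u"
    and mult_assoc: "(u \<cdot> v) \<cdot> w = u \<cdot> (v \<cdot> w)"
    and transposed_leibniz: "2 *s (z \<cdot> lie u v) = lie (z \<cdot> u) v + lie u (z \<cdot> v)"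

text \<open>The pairs \<open>(i, j)\<close> for which the bracket of \<open>e\<^sub>i\<close> and \<open>e\<^sub>j\<close> is given explicitly.\<close>

definition r_listed :: "nat \<Rightarrow> (nat \<times> nat) set" where
  "r_listed n = {(i, 1) | i. 2 \<le> i \<and> i \<le> 2*n - 2} \<union> {(i, 2*n + 1 - i) | i. 2 \<le> i \<and> i \<le> n}"

text \<open>The Lie algebra \<open>r\<^bsub>2n+2\<^esub>\<close> together with a basis
  \<open>e\<^sub>1, \<dots>, e\<^bsub>2n\<^esub>, x\<^sub>1, x\<^sub>2\<close> satisfying its multiplication table. Only the values of \<open>e\<close> on
  \<open>{1..2*n}\<close> matter.\<close>

locale r_lie_algebra = complex_lie_algebra scale lie
  for scale :: "complex \<Rightarrow> 'a::ab_group_add \<Rightarrow> 'a" (infixr "*s" 75)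
    and lie :: "'a \<Rightarrow> 'a \<Rightarrow> 'a" +
  fixes n :: nat and e :: "nat \<Rightarrow> 'a" and x1 x2 :: 'a
  assumes basis_distinct: "inj_on e {1..2*n}" "x1 \<notin> e ` {1..2*n}" "x2 \<notin> e ` {1..2*n}" "x1 \<noteq> x2"
    and basis_independent: "independent (e ` {1..2*n} \<union> {x1, x2})"
    and basis_span: "span (e ` {1..2*n} \<union> {x1, x2}) = UNIV"
    and lie_e_e1: "\<And>i. 2 \<le> i \<Longrightarrow> i \<le> 2*n - 2 \<Longrightarrow> lie (e i) (e 1) = e (i + 1)"
    and lie_e_e: "\<And>i. 2 \<le> i \<Longrightarrow> i \<le> n \<Longrightarrow> lie (e i) (e (2*n + 1 - i)) = (- 1) ^ i *s e (2*n)"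
    and lie_e_x1: "\<And>i. 1 \<le> i \<Longrightarrow> i \<le> 2*n - 1 \<Longrightarrow> lie (e i) x1 = of_nat i *s e i"
    and lie_e2n_x1: "lie (e (2*n)) x1 = of_nat (2*n + 1) *s e (2*n)"
    and lie_e_x2: "\<And>i. 2 \<le> i \<Longrightarrow> i \<le> 2*n - 1 \<Longrightarrow> lie (e i) x2 = e i"
    and lie_e2n_x2: "lie (e (2*n)) x2 = 2 *s e (2*n)"
    and lie_e_e_zero: "\<And>i j. i \<in> {1..2*n} \<Longrightarrow> j \<in> {1..2*n} \<Longrightarrow>
          (i, j) \<notin> r_listed n \<Longrightarrow> (j, i) \<notin> r_listed n \<Longrightarrow> lie (e i) (e j) = 0"
    and lie_e1_x2_zero: "lie (e 1) x2 = 0"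
    and lie_x1_x2_zero: "lie x1 x2 = 0"

text \<open>The multiplication table of \<open>TP(r\<^bsub>2n+2\<^esub>)\<close> in the basis \<open>e\<^sub>1, \<dots>, e\<^bsub>2n\<^esub>, x\<^sub>1, x\<^sub>2\<close>, for a
  commutative product.\<close>

definition TP_r_products ::
  "(complex \<Rightarrow> 'a::ab_group_add \<Rightarrow> 'a) \<Rightarrow> ('a \<Rightarrow> 'a \<Rightarrow> 'a) \<Rightarrow> nat \<Rightarrow> (nat \<Rightarrow> 'a) \<Rightarrow> 'a \<Rightarrow> 'a \<Rightarrow> bool" where
  "TP_r_products scale mult n e x1 x2 \<longleftrightarrow>
     mult x1 x1 = scale (of_nat ((2*n + 1)\<^sup>2)) (e (2*n)) \<and>
     mult x1 x2 = scale (of_nat (2 * (2*n + 1))) (e (2*n)) \<and>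
     mult x2 x2 = scale 4 (e (2*n)) \<and>
     (\<forall>i\<in>{1..2*n}. mult (e i) x1 = 0 \<and> mult (e i) x2 = 0) \<and>
     (\<forall>i\<in>{1..2*n}. \<forall>j\<in>{1..2*n}. mult (e i) (e j) = 0)"

end

theory Submission
  imports Defs
begin

text \<open>By the transposed Leibniz rule every multiplication operator \<open>\<phi> = z \<cdot> _\<close> satisfies
  \<open>2 \<phi> [u, v] = [\<phi> u, v] + [u, \<phi> v]\<close>. The torus \<open>x\<^sub>1, x\<^sub>2\<close> acts diagonally with weights \<open>w1\<close>, \<open>w2\<close>.
  Comparing coordinates in this identity for \<open>v = x\<^sub>j\<close> first shows that \<open>\<phi> x\<^sub>j\<close> lies in the span of
  \<open>x\<^sub>1, x\<^sub>2, e\<^bsub>2n\<^esub>\<close>, and then that \<open>\<phi>\<close> is diagonal on the \<open>e\<^sub>i\<close>, because twice the weight of \<open>e\<^sub>i\<close>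
  is never a weight. Hence \<open>\<phi>\<close> is \<open>l\<close> times the identity plus \<open>\<kappa>\<close> times the map sending the \<open>x\<^sub>j\<close> to
  \<open>(2n+1) e\<^bsub>2n\<^esub>\<close> and \<open>2 e\<^bsub>2n\<^esub>\<close>. Commutativity of the product forces \<open>l = 0\<close> and leaves the
  displayed table up to one scalar \<open>k\<close>. If \<open>k \<noteq> 0\<close>, the automorphism scaling \<open>e\<^sub>i\<close> for
  \<open>2 \<le> i < 2n\<close> by a square root of \<open>k\<close> normalises it to 1.\<close>

section \<open>Linearity of the bracket and half-derivations\<close>

context complex_lie_algebra
begin

lemma lie_simps [simp]:
  "lie (u + v) w = lie u w + lie v w" "lie w (u + v) = lie w u + lie w v"
  "lie (a *s u) w = a *s lie u w" "lie w (a *s u) = a *s lie w u"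
  "lie 0 w = 0" "lie w 0 = 0"
  using module_hom.add[OF module_hom_linearI[OF lie_linear_left]]
    module_hom.add[OF module_hom_linearI[OF lie_linear_right]]
    module_hom.scale[OF module_hom_linearI[OF lie_linear_left]]
    module_hom.scale[OF module_hom_linearI[OF lie_linear_right]]
    module_hom.zero[OF module_hom_linearI[OF lie_linear_left]]
    module_hom.zero[OF module_hom_linearI[OF lie_linear_right]]
  by auto

lemma lie_anticommute: "lie u v = - lie v u"
proof -
  have "lie (u + v) (u + v) = 0" by (rule lie_alternating)
  then show ?thesis 
    by (simp add: lie_alternating[of u] lie_alternating[of v] eq_neg_iff_add_eq_0)
      (simp add: add.commute)
qed

text \<open>These are the 1/2-derivations, with the denominator cleared.\<close>

definition half_derivation :: "('a \<Rightarrow> 'a) \<Rightarrow> bool" where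
  "half_derivation \<phi> \<longleftrightarrow> Vector_Spaces.linear scale scale \<phi> \<and>
     (\<forall>u v. 2 *s \<phi> (lie u v) = lie (\<phi> u) v + lie u (\<phi> v))"

lemma half_derivation_linear:
  assumes "half_derivation \<phi>"
  shows "\<phi> (u + v) = \<phi> u + \<phi> v" "\<phi> (a *s u) = a *s \<phi> u" "\<phi> 0 = 0"
  using assms module_hom.add[OF module_hom_linearI, of scale scale \<phi>]
    module_hom.scale[OF module_hom_linearI, of scale scale \<phi>]
    module_hom.zero[OF module_hom_linearI, of scale scale \<phi>]
  by (auto simp: half_derivation_def)

end

section \<open>Basis, weights and coordinates\<close>

context r_lie_algebra
begin

abbreviation "I \<equiv> {1..2*n+2}"

text \<open>Places \<open>x1\<close> and \<open>x2\<close> at the indices \<open>2*n+1\<close> and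
  \<open>2*n+2\<close>, so that weights and coordinates are handled uniformly over the whole
  basis.\<close>

definition b :: "nat \<Rightarrow> 'a" where
  "b i = (if i \<le> 2*n then e i else if i = 2*n+1 then x1 else x2)"

text \<open>The value jumps to \<open>2*n+1\<close> at the top because \<open>e (2*n)\<close> is, up
  to sign, the bracket of \<open>e i\<close> and \<open>e (2*n+1-i)\<close>, and weights add;
  likewise \<open>w2\<close> is 2 there.\<close>

definition w1 :: "nat \<Rightarrow> nat" where
  "w1 i = (if i < 2*n then i else if i = 2*n then 2*n+1 else 0)"

definition w2 :: "nat \<Rightarrow> nat" where
  "w2 i = (if i = 1 \<or> i > 2*n then 0 else if i < 2*n then 1 else 2)"

lemma b_simps:
  "i \<le> 2*n \<Longrightarrow> b i = e i" "b (Suc (2*n)) = x1" "b (Suc (Suc (2*n))) = x2"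
  by (auto simp: b_def)

lemma I_cases [consumes 1, case_names e x1 x2]:
  assumes "i \<in> I"
  obtains "i \<in> {1..2*n}" | "i = 2*n+1" | "i = 2*n+2"
  using assms by fastforce

lemma I_eq: "I = {1..2*n} \<union> {2*n+1, 2*n+2}"
  by auto

lemma basis_image: "b ` I = e ` {1..2*n} \<union> {x1, x2}"
  unfolding I_eq image_Un by (auto simp: b_def)

lemma inj_b: "inj_on b I"
proof (rule inj_onI)
  fix i j assume "i \<in> I" "j \<in> I" and eq: "b i = b j"
  have "e m \<noteq> x1" "e m \<noteq> x2" if "m \<in> {1..2*n}" for m
    using basis_distinct(2,3) that by blast+
  then show "i = j"
    using eq basis_distinct(4) inj_onD[OF basis_distinct(1), of i j]
    by (cases rule: I_cases[OF \<open>i \<in> I\<close>]; cases rule: I_cases[OF \<open>j \<in> I\<close>])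
      (simp_all add: b_simps eq_commute[of x1 "e j"] eq_commute[of x2 "e j"])
qed

lemma independent_b: "independent (b ` I)"
  unfolding basis_image by (rule basis_independent)

lemma span_b: "span (b ` I) = UNIV"
  unfolding basis_image by (rule basis_span)

text \<open>Meaningful only for \<open>k\<close> in \<open>I\<close>: \<open>b\<close> sends 0 to an
  unspecified vector and repeats \<open>x2\<close> beyond \<open>2*n+2\<close>.\<close>

definition c :: "nat \<Rightarrow> 'a \<Rightarrow> complex" where
  "c k v = representation (b ` I) v (b k)"

lemma c_linear [simp]:
  "c k (u + v) = c k u + c k v" "c k (a *s u) = a * c k u" "c k 0 = 0"
  using independent_b span_b
  by (simp_all add: c_def representation_add representation_scale representation_zero)

lemma c_uminus [simp]: "c k (- u) = - c k u"
  using c_linear(2)[of k "-1" u] by simp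

lemma c_b: "i \<in> I \<Longrightarrow> k \<in> I \<Longrightarrow> c k (b i) = (if k = i then 1 else 0)"
  unfolding c_def
  by (subst representation_basis[OF independent_b]) (auto simp: inj_on_eq_iff[OF inj_b])

lemma c_e: "i \<in> {1..2*n} \<Longrightarrow> k \<in> I \<Longrightarrow> c k (e i) = (if k = i then 1 else 0)"
  using c_b[of i k] by (simp add: b_def)

lemma c_x1: "k \<in> I \<Longrightarrow> c k x1 = (if k = 2*n+1 then 1 else 0)"
  using c_b[of "2*n+1" k] by (simp add: b_def)

lemma c_x2: "k \<in> I \<Longrightarrow> c k x2 = (if k = 2*n+2 then 1 else 0)"
  using c_b[of "2*n+2" k] by (simp add: b_def)

lemma basis_induct [case_names e x1 x2 add scale]:
  assumes "\<And>i. i \<in> {1..2*n} \<Longrightarrow> P (e i)" "P x1" "P x2"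
    and add: "\<And>u v. P u \<Longrightarrow> P v \<Longrightarrow> P (u + v)" and scale: "\<And>a u. P u \<Longrightarrow> P (a *s u)"
  shows "P v"
proof -
  have "v \<in> span (e ` {1..2*n} \<union> {x1, x2})" using basis_span by simp
  then show ?thesis
  proof (induction rule: span_induct)
    case base
    show ?case
      \<comment> \<open>The zero vector is obtained as \<open>0 *s x1\<close>.\<close>
      by (rule subspaceI) (use scale[OF \<open>P x1\<close>, of 0] add scale in simp_all)
  next
    case (step u)
    then show ?case using assms(1-3) by auto
  qed
qed

lemma c_eqI:
  assumes "\<And>k. k \<in> I \<Longrightarrow> c k u = c k v"
  shows "u = v"
proof -
  have "w = (\<Sum>x\<in>b ` I. representation (b ` I) w x *s x)" for w
    using sum_representation_eq[OF independent_b, of w "b ` I"] span_b by simp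
  moreover have "(\<Sum>x\<in>b ` I. representation (b ` I) u x *s x) = (\<Sum>x\<in>b ` I. representation (b ` I) v x *s x)"
    using assms by (intro sum.cong) (auto simp: c_def)
  ultimately show ?thesis by metis
qed

section \<open>Coordinates of brackets\<close>

lemma lie_b_x1: "i \<in> I \<Longrightarrow> lie (b i) x1 = of_nat (w1 i) *s b i"
  by (cases rule: I_cases, assumption)
    (auto simp: b_simps w1_def lie_e_x1 lie_e2n_x1[simplified] lie_alternating
      lie_anticommute[of x2 x1] lie_x1_x2_zero)

lemma lie_b_x2: "i \<in> I \<Longrightarrow> lie (b i) x2 = of_nat (w2 i) *s b i"
  by (cases rule: I_cases, assumption)
    (auto simp: b_simps w2_def lie_e_x2 lie_e2n_x2 lie_alternating lie_x1_x2_zero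
      lie_e1_x2_zero[simplified])

lemma c_lie_eigen:
  assumes "\<And>i. i \<in> I \<Longrightarrow> lie (b i) t = of_nat (w i) *s b i" "k \<in> I"
  shows "c k (lie v t) = of_nat (w k) * c k v"
proof (induction v rule: basis_induct)
  case (e i)
  then show ?case using assms(1)[of i] c_b[of i k] assms(2) by (auto simp: b_simps)
next
  case x1
  then show ?case using assms(1)[of "2*n+1"] c_x1 assms(2) by (auto simp: b_simps)
next
  case x2
  then show ?case using assms(1)[of "2*n+2"] c_x2 assms(2) by (auto simp: b_simps)
qed (auto simp: algebra_simps)

text \<open>Coordinate \<open>k\<close> of the half-derivation identity for \<open>b i\<close> and
  \<open>t\<close>. As \<open>t\<close> acts diagonally, it expresses
  \<open>(2 * w i - w k) * c k (\<phi> (b i))\<close> through \<open>\<phi> t\<close> alone.\<close>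

lemma c_half_derivation:
  assumes \<phi>: "half_derivation \<phi>"
    and t: "\<And>i. i \<in> I \<Longrightarrow> lie (b i) t = of_nat (w i) *s b i"
    and "i \<in> I" "k \<in> I"
  shows "2 * of_nat (w i) * c k (\<phi> (b i)) =
    of_nat (w k) * c k (\<phi> (b i)) + c k (lie (b i) (\<phi> t))"
proof -
  have "2 *s \<phi> (lie (b i) t) = lie (\<phi> (b i)) t + lie (b i) (\<phi> t)"
    using \<phi> by (simp add: half_derivation_def)
  then have "c k (2 *s \<phi> (lie (b i) t)) = c k (lie (\<phi> (b i)) t + lie (b i) (\<phi> t))"
    by simp
  then show ?thesis
    using c_lie_eigen[OF t \<open>k \<in> I\<close>] by (simp add: t[OF \<open>i \<in> I\<close>] half_derivation_linear[OF \<phi>])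
qed

lemmas c_half_derivation_x1 = c_half_derivation[OF _ lie_b_x1]
lemmas c_half_derivation_x2 = c_half_derivation[OF _ lie_b_x2]

text \<open>Only \<open>e (2*n+1-i)\<close> has a bracket with \<open>e i\<close> that reaches
  \<open>e (2*n)\<close>. Varying \<open>i\<close> thus detects the coordinates 2 to
  \<open>2*n-1\<close> of any vector.\<close>

lemma c_lie_e_top:
  assumes "2 \<le> i" "i < 2*n"
  obtains s :: complex where "s \<noteq> 0" "\<And>v. c (2*n) (lie (e i) v) = s * c (2*n+1-i) v"
proof -
  \<comment> \<open>The table lists each pair with the smaller index first; for \<open>i > n\<close>
    antisymmetry contributes the extra sign. Both branches equal \<open>(-1)^i\<close>.\<close>
  define s :: complex where "s = (if i \<le> n then (-1)^i else - ((-1)^(2*n+1-i)))"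
  have k: "2*n+1-i \<in> I" "2*n+1-i \<noteq> 2*n+1" "2*n+1-i \<noteq> 2*n+2" using assms by auto
  have "c (2*n) (lie (e i) v) = s * c (2*n+1-i) v" for v
  proof (induction v rule: basis_induct)
    case (e j)
    have c_j: "c (2*n+1-i) (e j) = (if 2*n+1-i = j then 1 else 0)"
      by (intro c_e e k)
    consider "j = 2*n+1-i" "i \<le> n" | "j = 2*n+1-i" "i > n" | "j = 1" "i \<le> 2*n-2"
      | "j = 1" "i = 2*n-1" | "i = 1" | "j \<noteq> 2*n+1-i" "j \<noteq> 1" "i \<noteq> 1"
      using assms by linarith
    then show ?case
    proof cases
      case 1
      then show ?thesis using assms c_j lie_e_e[of i] by (simp add: c_e s_def)
    next
      case 2
      then have "lie (e j) (e i) = (-1)^j *s e (2*n)"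
        using assms lie_e_e[of j] by simp
      with 2 show ?thesis using assms c_j lie_anticommute[of "e i" "e j"]
        by (simp add: c_e s_def)
    next
      case 3
      then have "i + 1 < 2*n" "Suc (2*n) - i \<noteq> 1" using assms by linarith+
      with 3 show ?thesis using assms c_j lie_e_e1[of i] by (simp add: c_e)
    next
      case 4
      then have "lie (e i) (e j) = 0"
        using assms by (intro lie_e_e_zero) (auto simp: r_listed_def)
      moreover have "Suc (2*n) - i \<noteq> 1" using assms by linarith
      ultimately show ?thesis using 4 assms c_j by (simp add: c_e)
    next
      case 5
      then show ?thesis using assms by simp
    next
      case 6
      then have "lie (e i) (e j) = 0"
        using assms e by (intro lie_e_e_zero) (auto simp: r_listed_def)
      with 6 e show ?thesis using assms c_j by (simp add: c_e)
    qed
  next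
    case x1
    then show ?case using assms k(2,3) lie_e_x1[of i] c_x1[OF k(1)] by (simp add: c_e)
  next
    case x2
    then show ?case using assms k(2,3) lie_e_x2[of i] c_x2[OF k(1)] by (simp add: c_e)
  qed (auto simp: algebra_simps)
  moreover have "s \<noteq> 0" by (simp add: s_def)
  ultimately show ?thesis using that by blast
qed

text \<open>Detects coordinate 1, which \<open>c_lie_e_top\<close> does not reach: among the basis
  vectors only \<open>e 1\<close> is bracketed with \<open>e 2\<close> into
  \<open>e 3\<close>.\<close>

lemma c_lie_e2_3:
  assumes "n \<ge> 3"
  shows "c 3 (lie (e 2) v) = c 1 v"
proof (induction v rule: basis_induct)
  case (e j)
  consider "j = 1" | "j = 2*n-1" | "j \<noteq> 1" "j \<noteq> 2*n-1" by blast
  then show ?case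
  proof cases
    case 1
    then show ?thesis using assms lie_e_e1[of 2] by (simp add: c_e)
  next
    case 2
    then show ?thesis using assms lie_e_e[of 2] by (simp add: c_e)
  next
    case 3
    then have "lie (e 2) (e j) = 0"
      using assms e by (intro lie_e_e_zero) (auto simp: r_listed_def)
    with 3 e show ?thesis using assms by (simp add: c_e)
  qed
next
  case x1
  then show ?case using assms lie_e_x1[of 2] by (simp add: c_e c_x1)
next
  case x2
  then show ?case using assms lie_e_x2[of 2] by (simp add: c_e c_x2)
qed (auto simp: algebra_simps)

lemma lie_e_e2n:
  assumes "i \<in> {1..2*n}"
  shows "lie (e i) (e (2*n)) = 0"
  using assms by (intro lie_e_e_zero) (auto simp: r_listed_def)

section \<open>Classification of the half-derivations\<close>

lemma half_derivation_torus:
  assumes \<phi>: "half_derivation \<phi>" and n: "n \<ge> 3" and k: "k \<in> {1..<2*n}"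
  shows "c k (\<phi> x1) = 0" "c k (\<phi> x2) = 0"
proof -
  \<comment> \<open>The half-derivation identity applied to \<open>lie x1 x2 = 0\<close>.\<close>
  have commute: "of_nat (w2 k) * c k (\<phi> x1) = of_nat (w1 k) * c k (\<phi> x2)" if "k \<in> {1..<2*n}" for k
    using c_half_derivation_x2[OF \<phi>, of "2*n+1" k] that
      c_lie_eigen[OF lie_b_x1, of k "\<phi> x2"] by (simp add: b_simps w2_def lie_anticommute[of x1 "\<phi> x2"])
  have "c k (\<phi> x1) = 0 \<and> c k (\<phi> x2) = 0"
  proof (cases "k = 1")
    case True
    \<comment> \<open>Since \<open>w2 1 = 0\<close>, \<open>commute\<close> gives
      \<open>c 1 (\<phi> x2) = 0\<close>, so the identity for \<open>e 2\<close> and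
      \<open>x2\<close> kills this coordinate; the one for \<open>e 2\<close> and \<open>x1\<close>
      then kills \<open>c 1 (\<phi> x1)\<close>.\<close>
    have "c 3 (\<phi> (e 2)) = 0"
      using c_half_derivation_x2[OF \<phi>, of 2 3] n commute[of 1]
      by (simp add: b_simps w1_def w2_def c_lie_e2_3)
    then show ?thesis
      using c_half_derivation_x1[OF \<phi>, of 2 3] n True commute[of 1]
      by (simp add: b_simps w1_def w2_def c_lie_e2_3)
  next
    case False
    define i where "i = 2*n+1-k"
    have i: "2 \<le> i" "i < 2*n" "k = 2*n+1-i" using k False by (auto simp: i_def)
    obtain s where s: "s \<noteq> 0" "\<And>v. c (2*n) (lie (e i) v) = s * c k v"
      using c_lie_e_top[OF i(1,2)] i(3) by blast
    \<comment> \<open>Here \<open>2 * w2 i\<close> and \<open>w2 (2*n)\<close> are both 2, so the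
      unknown \<open>c (2*n) (\<phi> (e i))\<close> cancels and \<open>s * c k (\<phi> x2)\<close>
      is left.\<close>
    have "c k (\<phi> x2) = 0"
      using c_half_derivation_x2[OF \<phi>, of i "2*n"] i(1,2) s n by (simp add: b_simps w2_def)
    then show ?thesis using commute[OF k] k False by (simp add: w2_def)
  qed
  then show "c k (\<phi> x1) = 0" "c k (\<phi> x2) = 0" by auto
qed

lemma eq_torus_plus_top:
  assumes "n \<ge> 1" "\<And>k. k \<in> {1..<2*n} \<Longrightarrow> c k u = 0"
  shows "u = c (2*n+1) u *s x1 + c (2*n+2) u *s x2 + c (2*n) u *s e (2*n)"
proof (rule c_eqI)
  fix k assume "k \<in> I"
  then consider "k \<in> {1..<2*n}" | "k = 2*n" | "k = 2*n+1" | "k = 2*n+2" by fastforce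
  then show "c k u = c k (c (2*n+1) u *s x1 + c (2*n+2) u *s x2 + c (2*n) u *s e (2*n))"
    using assms \<open>k \<in> I\<close> by cases (auto simp: c_x1 c_x2 c_e)
qed

text \<open>Doubling \<open>(1, 0)\<close> gives \<open>(2, 0)\<close>, not a weight. For
  \<open>2 \<le> i < 2*n\<close> the second entry 2 would force \<open>k = 2*n\<close>, whose first
  entry is odd. For \<open>i = 2*n\<close> the second entry is 4, too large.\<close>

lemma double_weight_not_weight:
  assumes "i \<in> {1..2*n}" "k \<in> I"
  shows "2 * w1 i \<noteq> w1 k \<or> 2 * w2 i \<noteq> w2 k"
  using assms unfolding w1_def w2_def by (auto split: if_splits) presburger+

proposition half_derivation_form:
  assumes \<phi>: "half_derivation \<phi>" and n: "n \<ge> 3"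
  shows "\<exists>l \<kappa>. (\<forall>i\<in>{1..2*n}. \<phi> (e i) = l *s e i) \<and>
    \<phi> x1 = l *s x1 + (of_nat (2*n+1) * \<kappa>) *s e (2*n) \<and>
    \<phi> x2 = l *s x2 + (2 * \<kappa>) *s e (2*n)"
proof -
  define p1 q1 r1 p2 q2 r2 where
    "p1 = c (2*n+1) (\<phi> x1)" and "q1 = c (2*n+2) (\<phi> x1)" and "r1 = c (2*n) (\<phi> x1)" and
    "p2 = c (2*n+1) (\<phi> x2)" and "q2 = c (2*n+2) (\<phi> x2)" and "r2 = c (2*n) (\<phi> x2)"
  have x1: "\<phi> x1 = p1 *s x1 + q1 *s x2 + r1 *s e (2*n)"
    using eq_torus_plus_top[of "\<phi> x1"] half_derivation_torus(1)[OF \<phi> n] n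
    by (simp add: p1_def q1_def r1_def)
  have x2: "\<phi> x2 = p2 *s x1 + q2 *s x2 + r2 *s e (2*n)"
    using eq_torus_plus_top[of "\<phi> x2"] half_derivation_torus(2)[OF \<phi> n] n
    by (simp add: p2_def q2_def r2_def)
  have lie_e: "lie (e i) (p *s x1 + q *s x2 + r *s e (2*n))
      = (p * of_nat (w1 i) + q * of_nat (w2 i)) *s e i" if "i \<in> {1..2*n}" for i p q r
    using that lie_b_x1[of i] lie_b_x2[of i] by (simp add: b_simps lie_e_e2n scale_left_distrib)
  have coord: "(2 * of_nat (w1 i) - of_nat (w1 k)) * c k (\<phi> (e i)) =
        (if k = i then p1 * of_nat (w1 i) + q1 * of_nat (w2 i) else 0)"
      "(2 * of_nat (w2 i) - of_nat (w2 k)) * c k (\<phi> (e i)) =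
        (if k = i then p2 * of_nat (w1 i) + q2 * of_nat (w2 i) else 0)"
    if "i \<in> {1..2*n}" "k \<in> I" for i k
    using c_half_derivation_x1[OF \<phi>, of i k] c_half_derivation_x2[OF \<phi>, of i k] that
    by (simp_all add: b_simps x1 x2 lie_e c_e left_diff_distrib del: lie_simps(2,4))
  have diag: "\<phi> (e i) = c i (\<phi> (e i)) *s e i" if i: "i \<in> {1..2*n}" for i
  proof (rule c_eqI)
    fix k assume k: "k \<in> I"
    show "c k (\<phi> (e i)) = c k (c i (\<phi> (e i)) *s e i)"
    proof (cases "k = i")
      case False
      have "(2 * of_nat (w1 i) - of_nat (w1 k) :: complex) \<noteq> 0 \<or>
            (2 * of_nat (w2 i) - of_nat (w2 k) :: complex) \<noteq> 0"
        using double_weight_not_weight[OF i k]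
        by (metis (mono_tags, lifting) eq_iff_diff_eq_0 of_nat_eq_iff of_nat_mult of_nat_numeral)
      then have "c k (\<phi> (e i)) = 0" using coord[OF i k] False by auto
      then show ?thesis using False i k by (simp add: c_e)
    qed (use i k in \<open>simp add: c_e\<close>)
  qed
  \<comment> \<open>The case \<open>k = i\<close> of \<open>coord\<close>, where
    \<open>2 * w - w = w\<close>.\<close>
  have eig: "of_nat (w1 i) * c i (\<phi> (e i)) = p1 * of_nat (w1 i) + q1 * of_nat (w2 i)"
      "of_nat (w2 i) * c i (\<phi> (e i)) = p2 * of_nat (w1 i) + q2 * of_nat (w2 i)"
    if "i \<in> {1..2*n}" for i
    using coord[OF that, of i] that by (simp_all add: algebra_simps)
  have p2: "p2 = 0" using eig(2)[of 1] n by (simp add: w1_def w2_def)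
  \<comment> \<open>The vectors \<open>e 2\<close> and \<open>e 3\<close> have second weight 1, so
    both have eigenvalue \<open>q2\<close>; substituting this into the first equation leaves two
    equations in \<open>p1\<close> and \<open>q1\<close>.\<close>
  have q12: "2 * q2 = 2 * p1 + q1" "3 * q2 = 3 * p1 + q1"
    using eig[of 2] eig[of 3] n p2 by (simp_all add: w1_def w2_def algebra_simps)
  have "q2 = 3 * q2 - 2 * q2" by simp
  also have "\<dots> = p1" unfolding q12 by simp
  finally have q: "q2 = p1" "q1 = 0" using q12 by simp_all
  have e: "\<phi> (e i) = p1 *s e i" if "i \<in> {1..2*n}" for i
  proof -
    have "of_nat (w1 i) * c i (\<phi> (e i)) = of_nat (w1 i) * p1" "w1 i \<noteq> 0"
      using eig(1)[OF that] q that by (auto simp: w1_def)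
    then show ?thesis using diag[OF that] by simp
  qed
  \<comment> \<open>The top coordinate of the identity for \<open>lie x1 x2 = 0\<close>. It makes
    \<open>r1\<close> and \<open>r2\<close> proportional to the weights of \<open>e (2*n)\<close>,
    with common factor \<open>r2 / 2\<close> as \<open>\<kappa>\<close>.\<close>
  have "2 * r1 = of_nat (2*n+1) * r2"
    using c_half_derivation_x2[OF \<phi>, of "2*n+1" "2*n"] n
      c_lie_eigen[OF lie_b_x1, of "2*n" "\<phi> x2"]
    by (simp add: b_simps w1_def w2_def lie_anticommute[of x1 "\<phi> x2"] r1_def r2_def)
  then have r: "r1 = of_nat (2*n+1) * (r2 / 2)" "r2 = 2 * (r2 / 2)"
    by (simp_all add: mult.commute)
  have "\<phi> x1 = p1 *s x1 + (of_nat (2*n+1) * (r2 / 2)) *s e (2*n)"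
    unfolding r(1)[symmetric] using x1 q by simp
  moreover have "\<phi> x2 = p1 *s x2 + (2 * (r2 / 2)) *s e (2*n)"
    unfolding r(2)[symmetric] using x2 p2 q by simp
  ultimately show ?thesis using e by blast
qed

section \<open>Rescaling the basis\<close>

text \<open>The substitution \<open>e\<^sub>i \<mapsto> r e\<^sub>i\<close> for \<open>2 \<le> i < 2n\<close> multiplies \<open>e\<^bsub>2n\<^esub>\<close> by \<open>r\<^sup>2\<close>, since
  \<open>e\<^bsub>2n\<^esub>\<close> is a bracket of two of these vectors.\<close>

definition rescale :: "complex \<Rightarrow> nat \<Rightarrow> complex" where
  "rescale r i = (if i = 1 then 1 else if i = 2*n then r\<^sup>2 else r)"

lemma r_lie_algebra_rescale:
  assumes n: "n \<ge> 3" and r: "r \<noteq> 0"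
  shows "r_lie_algebra scale lie n (\<lambda>i. rescale r i *s e i) x1 x2"
proof -
  let ?e = "\<lambda>i. rescale r i *s e i"
  let ?B = "?e ` {1..2*n} \<union> {x1, x2}"
  have nz: "rescale r i \<noteq> 0" for i using r by (simp add: rescale_def)
  have c_e': "c k (?e i) = (if k = i then rescale r i else 0)" if "i \<in> {1..2*n}" "k \<in> I" for i k
    using that by (simp add: c_e)
  have inj: "inj_on ?e {1..2*n}"
  proof (rule inj_onI)
    fix i j assume ij: "i \<in> {1..2*n}" "j \<in> {1..2*n}" "?e i = ?e j"
    have "i \<in> I" using ij(1) by simp
    then have "rescale r i = (if i = j then rescale r j else 0)"
      using c_e'[OF ij(1), of i] c_e'[OF ij(2), of i] unfolding ij(3) by simp
    then show "i = j" using nz[of i] by metis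
  qed
  have x: "x1 \<notin> ?e ` {1..2*n}" "x2 \<notin> ?e ` {1..2*n}"
  proof -
    have k: "2*n+1 \<in> I" "2*n+2 \<in> I" by simp_all
    have "x1 \<noteq> ?e i \<and> x2 \<noteq> ?e i" if i: "i \<in> {1..2*n}" for i
    proof -
      have "2*n+1 \<noteq> i" "2*n+2 \<noteq> i" using i by auto
      then have "c (2*n+1) (?e i) = 0" "c (2*n+2) (?e i) = 0"
        by (simp_all only: c_e'[OF i k(1)] c_e'[OF i k(2)] if_False)
      moreover have "c (2*n+1) x1 = 1" "c (2*n+2) x2 = 1"
        by (simp_all only: c_x1[OF k(1)] c_x2[OF k(2)] refl if_True)
      ultimately show ?thesis by (metis zero_neq_one)
    qed
    then show "x1 \<notin> ?e ` {1..2*n}" "x2 \<notin> ?e ` {1..2*n}" by blast+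
  qed
  have "e i \<in> span ?B" if "i \<in> {1..2*n}" for i
  proof -
    have "inverse (rescale r i) *s ?e i \<in> span ?B"
      using that by (intro span_scale span_base) auto
    then show ?thesis using nz[of i] by simp
  qed
  then have "e ` {1..2*n} \<union> {x1, x2} \<subseteq> span ?B" by (auto intro: span_base)
  then have span: "span ?B = UNIV"
    
    using span_minimal[OF _ subspace_span] basis_span by blast
  interpret fd: finite_dimensional_vector_space scale "b ` I"
    by unfold_locales (use independent_b span_b in auto)
  have card_B: "card ?B = card I"
  proof -
    have "card ?B = card (?e ` {1..2*n}) + card {x1, x2}"
      using x by (intro card_Un_disjoint) auto
    then show ?thesis using card_image[OF inj] basis_distinct(4) by simp
  qed
  \<comment> \<open>A spanning set with as many elements as the dimension is independent.\<close>
  have indep: "independent ?B"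
  proof (rule fd.card_le_dim_spanning[of _ UNIV])
    show "card ?B \<le> dim UNIV"
      using card_B card_image[OF inj_b] dim_eq_card_independent[OF independent_b]
        span_b by (metis dim_span order_refl)
  qed (use span in auto)
  show ?thesis
  proof (intro r_lie_algebra.intro r_lie_algebra_axioms.intro)
    show "complex_lie_algebra scale lie" by unfold_locales
    show "inj_on ?e {1..2*n}" by (rule inj)
    show "x1 \<notin> ?e ` {1..2*n}" "x2 \<notin> ?e ` {1..2*n}" by (rule x)+
    show "x1 \<noteq> x2" by (rule basis_distinct)
    show "independent ?B" by (rule indep)
    show "span ?B = UNIV" by (rule span)
    show "lie (?e i) (?e 1) = ?e (i+1)" if "2 \<le> i" "i \<le> 2*n-2" for i
    proof -
      have "rescale r (i+1) = rescale r i" "rescale r 1 = 1"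
        using that n by (auto simp: rescale_def)
      then show ?thesis using lie_e_e1[OF that] by (simp only: lie_simps scale_one)
    qed
    show "lie (?e i) (?e (2*n+1-i)) = (-1)^i *s ?e (2*n)" if "2 \<le> i" "i \<le> n" for i
    proof -
      have "rescale r i = r" "rescale r (2*n+1-i) = r" "rescale r (2*n) = r * r"
        using that n by (auto simp: rescale_def power2_eq_square)
      then show ?thesis using lie_e_e[OF that] by (simp only: lie_simps scale_scale mult_ac)
    qed
    show "lie (?e i) x1 = of_nat i *s ?e i" if "1 \<le> i" "i \<le> 2*n-1" for i
      using lie_e_x1[OF that] by (simp add: mult.commute)
    show "lie (?e (2*n)) x1 = of_nat (2*n+1) *s ?e (2*n)"
      by (simp only: lie_simps lie_e2n_x1 scale_left_commute[of "rescale r (2*n)"])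
    show "lie (?e i) x2 = ?e i" if "2 \<le> i" "i \<le> 2*n-1" for i
      using lie_e_x2[OF that] by simp
    show "lie (?e (2*n)) x2 = 2 *s ?e (2*n)"
      by (simp only: lie_simps lie_e2n_x2 scale_left_commute[of "rescale r (2*n)"])
    show "lie (?e i) (?e j) = 0"
      if "i \<in> {1..2*n}" "j \<in> {1..2*n}" "(i,j) \<notin> r_listed n" "(j,i) \<notin> r_listed n" for i j
      by (simp only: lie_simps lie_e_e_zero[OF that] scale_zero_right)
    show "lie (?e 1) x2 = 0" by (simp only: lie_simps lie_e1_x2_zero scale_zero_right)
    show "lie x1 x2 = 0" by (rule lie_x1_x2_zero)
  qed
qed

end

section \<open>Determination of the product\<close>

context transposed_poisson_algebra
begin

lemma half_derivation_mult: "half_derivation ((\<cdot>) z)"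
  using mult_linear_right transposed_leibniz by (simp add: half_derivation_def)

lemma mult_simps:
  "(u + v) \<cdot> w = u \<cdot> w + v \<cdot> w" "w \<cdot> (u + v) = w \<cdot> u + w \<cdot> v"
  "(a *s u) \<cdot> w = a *s (u \<cdot> w)" "w \<cdot> (a *s u) = a *s (w \<cdot> u)"
  using half_derivation_linear[OF half_derivation_mult, of w] mult_commute[of _ w] by simp_all

end

theorem theorem3p11:
  fixes n :: nat
    and scale :: "complex \<Rightarrow> 'a::ab_group_add \<Rightarrow> 'a"
    and lie mult :: "'a \<Rightarrow> 'a \<Rightarrow> 'a"
    and e :: "nat \<Rightarrow> 'a" and x1 x2 :: 'a
  assumes "n \<ge> 3"
    and "r_lie_algebra scale lie n e x1 x2"
    and "transposed_poisson_algebra scale lie mult"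
  shows "(\<forall>u v. mult u v = 0) \<or>
    (\<exists>e' x1' x2'. r_lie_algebra scale lie n e' x1' x2' \<and> TP_r_products scale mult n e' x1' x2')"
proof -
  interpret r_lie_algebra scale lie n e x1 x2 by fact
  interpret transposed_poisson_algebra scale lie mult by fact
  note n = \<open>n \<ge> 3\<close>
  have "\<forall>z. \<exists>l \<kappa>. (\<forall>i\<in>{1..2*n}. mult z (e i) = scale l (e i)) \<and>
     mult z x1 = scale l x1 + scale (of_nat (2*n+1) * \<kappa>) (e (2*n)) \<and>
     mult z x2 = scale l x2 + scale (2 * \<kappa>) (e (2*n))"
    using half_derivation_form[OF half_derivation_mult n] by (rule allI)
  then obtain l \<kappa> where
    me: "\<And>z i. i \<in> {1..2*n} \<Longrightarrow> mult z (e i) = scale (l z) (e i)" and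
    mx1: "\<And>z. mult z x1 = scale (l z) x1 + scale (of_nat (2*n+1) * \<kappa> z) (e (2*n))" and
    mx2: "\<And>z. mult z x2 = scale (l z) x2 + scale (2 * \<kappa> z) (e (2*n))"
    unfolding choice_iff by blast
  \<comment> \<open>The product \<open>mult (e i) x1\<close> has \<open>x1\<close>-coordinate
    \<open>l (e i)\<close>, whereas \<open>mult x1 (e i)\<close> is a multiple of
    \<open>e i\<close>.\<close>
  have le: "l (e i) = 0" if i: "i \<in> {1..2*n}" for i
  proof -
    have "c (2*n+1) (mult (e i) x1) = c (2*n+1) (mult x1 (e i))" by (simp add: mult_commute)
    then show ?thesis using i n by (simp add: me mx1 c_e c_x1)
  qed
  \<comment> \<open>With \<open>l (e 1) = 0\<close>, the products of \<open>e 1\<close> with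
    \<open>x1\<close> and \<open>x2\<close> are multiples of \<open>e (2*n)\<close>, yet in the
    other order they are \<open>l x1\<close> and \<open>l x2\<close> times
    \<open>e 1\<close>.\<close>
  have lx: "l x1 = 0 \<and> l x2 = 0"
    using arg_cong[OF mult_commute[of "e 1" x1], of "c 1"] arg_cong[OF mult_commute[of "e 1" x2], of "c 1"]
      n le[of 1] by (simp add: me mx1 mx2 c_e c_x1 c_x2)
  have ex: "mult (e i) x1 = 0" "mult (e i) x2 = 0" "mult x1 (e i) = 0" "mult x2 (e i) = 0"
    if "i \<in> {1..2*n}" for i
    using me[OF that, of x1] me[OF that, of x2] lx mult_commute[of "e i" x1]
      mult_commute[of "e i" x2] by simp_all
  have ee: "mult (e i) (e j) = 0" if "i \<in> {1..2*n}" "j \<in> {1..2*n}" for i j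
    using me[OF that(2), of "e i"] le[OF that(1)] by simp
  \<comment> \<open>Commutativity of \<open>x1\<close> with \<open>x2\<close> makes
    \<open>\<kappa> x1\<close> and \<open>\<kappa> x2\<close> proportional to \<open>2*n+1\<close>
    and 2; \<open>k\<close> is the common factor.\<close>
  define k where "k = \<kappa> x2 / 2"
  have "2 * \<kappa> x1 = of_nat (2*n+1) * \<kappa> x2"
    using arg_cong[OF mult_commute[of x1 x2], of "c (2*n)"] n lx
    by (simp add: mx1 mx2 c_e c_x1 c_x2)
  then have k: "\<kappa> x1 = of_nat (2*n+1) * k" "\<kappa> x2 = 2 * k" by (simp_all add: k_def field_simps)
  have coeffs: "of_nat (2*n+1) * \<kappa> x1 = of_nat ((2*n+1)\<^sup>2) * k"
      "2 * \<kappa> x1 = of_nat (2*(2*n+1)) * k" "2 * \<kappa> x2 = 4 * k"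
    unfolding k power2_eq_square of_nat_mult by (simp_all only: mult.assoc of_nat_numeral) simp
  have xx: "mult x1 x1 = scale (of_nat ((2*n+1)\<^sup>2) * k) (e (2*n))"
      "mult x1 x2 = scale (of_nat (2*(2*n+1)) * k) (e (2*n))"
      "mult x2 x2 = scale (4 * k) (e (2*n))"
    using mx1[of x1] mx2[of x1] mx2[of x2] lx unfolding coeffs by simp_all
  show ?thesis
  proof (cases "k = 0")
    case True
    have "mult u v = 0" for u v
    proof (induction v rule: basis_induct)
      case (e j)
      then show ?case by (induction u rule: basis_induct) (use ex ee in \<open>auto simp: mult_simps\<close>)
    next
      case x1
      show ?case
        by (induction u rule: basis_induct) (use ex xx mult_commute[of x2 x1] True in \<open>auto simp: mult_simps\<close>)
    next
      case x2
      show ?case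
        by (induction u rule: basis_induct) (use ex xx True in \<open>auto simp: mult_simps\<close>)
    qed (auto simp: mult_simps)
    then show ?thesis by blast
  next
    case False
    \<comment> \<open>The new top vector is \<open>k *s e (2*n)\<close>, which absorbs the factor
      \<open>k\<close> of all three products; \<open>x1\<close> and \<open>x2\<close> stay
      fixed.\<close>
    let ?e = "\<lambda>i. scale (rescale (csqrt k) i) (e i)"
    have top: "rescale (csqrt k) (2*n) = k" using n by (simp add: rescale_def)
    have "TP_r_products scale mult n ?e x1 x2"
      unfolding TP_r_products_def mult_simps top scale_scale xx using ex ee by simp
    moreover have "r_lie_algebra scale lie n ?e x1 x2"
      using False n by (intro r_lie_algebra_rescale) auto
    ultimately show ?thesis by blast
  qed
qed

end
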